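(* For every graph $G$, the 1-subdivision $S(G)$ is proper conflict-free $(\mathrm{degree}+2)$-choosable.
   Context: All graphs are simple, finite and undirected. $d_G(v)$ denotes the degree of $v$ in $G$. For a graph $G$, the 1-subdivision $S(G)$ of $G$ is the graph obtained from $G$ by replacing each edge with a path of length 2 (i.e. subdividing each edge exactly once). Given a graph $G$ and a mapping $f:V(G)\to\mathbb{N}$, an $f$-list assignment of $G$ is a function $L$ that maps each $v\in V(G)$ to a set $L(v)$ of at least $f(v)$ colors. For an $f$-list assignment $L$, a proper conflict-free $L$-coloring of $G$ is a coloring $\phi$ of $V(G)$ such that (i) $\phi(v)\in L(v)$ for every $v\in V(G)$, (ii) $\phi$ is proper, i.e. adjacent vertices receive distinct colors, and (iii) for every non-isolated vertex $v\in V(G)$ there is a color that appears exactly once in the neighborhood of $v$ (i.e. is assigned to exactly one neighbor of $v$). $G$ is proper conflict-free $f$-choosable if for every $f$-list assignment $L$ of $G$ there exists a proper conflict-free $L$-coloring of $G$. For a non-negative integer $k$, $G$ is proper conflict-free $(\mathrm{degree}+k)$-choosable if $G$ is proper conflict-free $f$-choosable for the mapping $f(v)=d_G(v)+k$ for every $v\in V(G)$. (For $S(G)$, the degrees are those in $S(G)$.) *)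

theory Defs
  imports "Graph_Theory.Pair_Digraph"
begin

text \<open>
  Finite simple undirected graphs are the symmetric loop-free digraphs of the locale
  \<^locale>\<open>pair_graph\<close>: an undirected edge \<open>uv\<close> is the pair of arcs \<open>(u, v)\<close>, \<open>(v, u)\<close>.
  Under this encoding \<^const>\<open>out_degree\<close> is the usual degree.
\<close>

definition neighborhood :: "'v pair_pre_digraph \<Rightarrow> 'v \<Rightarrow> 'v set" where
  "neighborhood G v = {u. v \<rightarrow>\<^bsub>G\<^esub> u}"

definition uedges :: "'v pair_pre_digraph \<Rightarrow> 'v set set" where
  "uedges G = {{u, v} | u v. u \<rightarrow>\<^bsub>G\<^esub> v}"

text \<open>
  The vertex subdividing the edge \<open>uv\<close> is \<open>Inr {u, v}\<close>.  It is joined to \<open>Inl v\<close> as well as to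
  \<open>Inl u\<close> because \<open>(v, u)\<close> is an arc too.
\<close>

definition one_subdivision :: "'v pair_pre_digraph \<Rightarrow> ('v + 'v set) pair_pre_digraph" where
  "one_subdivision G =
     \<lparr> pverts = Inl ` pverts G \<union> Inr ` uedges G,
       parcs = {(Inl u, Inr {u, v}) | u v. u \<rightarrow>\<^bsub>G\<^esub> v} \<union> {(Inr {u, v}, Inl u) | u v. u \<rightarrow>\<^bsub>G\<^esub> v} \<rparr>"

text \<open>
  Lists may be infinite; since \<^const>\<open>card\<close> is \<open>0\<close> on infinite sets, that case is separate.
\<close>

definition list_assignment ::
    "'v pair_pre_digraph \<Rightarrow> ('v \<Rightarrow> nat) \<Rightarrow> ('v \<Rightarrow> 'c set) \<Rightarrow> bool" where
  "list_assignment G f L \<longleftrightarrow> (\<forall>v\<in>pverts G. infinite (L v) \<or> f v \<le> card (L v))"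

definition proper_conflict_free_coloring ::
    "'v pair_pre_digraph \<Rightarrow> ('v \<Rightarrow> 'c set) \<Rightarrow> ('v \<Rightarrow> 'c) \<Rightarrow> bool" where
  "proper_conflict_free_coloring G L \<phi> \<longleftrightarrow>
     (\<forall>v\<in>pverts G. \<phi> v \<in> L v) \<and>
     (\<forall>u v. u \<rightarrow>\<^bsub>G\<^esub> v \<longrightarrow> \<phi> u \<noteq> \<phi> v) \<and>
     (\<forall>v\<in>pverts G. neighborhood G v \<noteq> {} \<longrightarrow>
        (\<exists>c. \<exists>!u. u \<in> neighborhood G v \<and> \<phi> u = c))"

text \<open>
  The type of colors is a parameter, so that a theorem about an arbitrary type \<open>'c\<close> covers lists of
  colors of any kind.
\<close>

definition proper_conflict_free_choosable ::
    "'c itself \<Rightarrow> 'v pair_pre_digraph \<Rightarrow> ('v \<Rightarrow> nat) \<Rightarrow> bool" where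
  "proper_conflict_free_choosable TYPE('c) G f \<longleftrightarrow>
     (\<forall>L :: 'v \<Rightarrow> 'c set. list_assignment G f L \<longrightarrow>
        (\<exists>\<phi>. proper_conflict_free_coloring G L \<phi>))"

definition proper_conflict_free_degree_plus_choosable ::
    "'c itself \<Rightarrow> 'v pair_pre_digraph \<Rightarrow> nat \<Rightarrow> bool" where
  "proper_conflict_free_degree_plus_choosable TYPE('c) G k \<longleftrightarrow>
     proper_conflict_free_choosable TYPE('c) G (\<lambda>v. out_degree G v + k)"

lemma out_degree_eq_card_neighborhood:
  fixes G :: "'v pair_pre_digraph"
  shows "out_degree G v = card (neighborhood G v)"
proof -
  have "out_arcs G v = Pair v ` neighborhood G v"
    by (auto simp: out_arcs_def neighborhood_def)
  then show ?thesis
    by (simp add: out_degree_def card_image inj_on_def)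
qed

lemma pair_graph_one_subdivision:
  assumes "pair_graph G"
  shows "pair_graph (one_subdivision G)"
proof -
  interpret pair_graph G by fact
  have arcD: "u \<in> pverts G" "v \<in> pverts G" if "(u, v) \<in> parcs G" for u v
    using that by (auto dest: in_arcsD1 in_arcsD2)
  have edgeI: "{u, v} \<in> uedges G" if "(u, v) \<in> parcs G" for u v
    using that by (auto simp: uedges_def)
  have "uedges G = (\<lambda>(u, v). {u, v}) ` parcs G"
    by (auto simp: uedges_def)
  then have fin: "finite (uedges G)"
    using pair_finite_arcs by simp
  let ?A = "(\<lambda>(u, v). (Inl u, Inr {u, v})) ` parcs G \<union> (\<lambda>(u, v). (Inr {u, v}, Inl u)) ` parcs G"
  have "parcs (one_subdivision G) = ?A"
    by (auto simp: one_subdivision_def)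
  then have fin': "finite (parcs (one_subdivision G))"
    using pair_finite_arcs by simp
  have "sym (parcs (one_subdivision G))"
    by (auto simp: one_subdivision_def sym_def)
  then have "symmetric (with_proj (one_subdivision G))"
    by (simp add: symmetric_def)
  then show ?thesis
    using fin fin' pair_finite_verts
    by unfold_locales (auto simp: one_subdivision_def dest: arcD edgeI)
qed

lemma neighborhood_one_subdivision_Inl:
  "neighborhood (one_subdivision G) (Inl u) = (\<lambda>v. Inr {u, v}) ` neighborhood G u"
  by (auto simp: neighborhood_def one_subdivision_def)

lemma neighborhood_one_subdivision_Inr:
  assumes "pair_graph G" "u \<rightarrow>\<^bsub>G\<^esub> v"
  shows "neighborhood (one_subdivision G) (Inr {u, v}) = {Inl u, Inl v}"
proof -
  interpret pair_graph G by fact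
  have "(v, u) \<in> parcs G"
    using assms arcs_symmetric by simp
  then show ?thesis
    using assms(2) by (auto simp: neighborhood_def one_subdivision_def doubleton_eq_iff)
qed

end

theory Submission
  imports Defs
begin

text \<open>
  Induction on the vertices: remove \<open>v\<close> of degree \<open>d\<close>, color the rest, and put \<open>v\<close> back.  A neighbor of
  \<open>v\<close> loses a neighbor in the smaller graph, so its list can spare one color there; deleting a fixed
  \<open>x \<in> L(v)\<close> from all neighboring lists makes \<open>x\<close> available at \<open>v\<close>.  Then each edge \<open>vu\<close> must avoid
  \<open>x\<close>, the color of \<open>u\<close> and the color that was unique at \<open>u\<close>.  One color remains in its list, and
  at least two if \<open>x\<close> is not in that list.  A suitable choice gives \<open>v\<close> a unique color unless every
  remaining color \<open>c\<close> is forced (the only one left) on two or more edges.  Hence it suffices that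
  \<open>d \<le> 1\<close>, or \<open>x\<close> lies in at most three, and not in all, of the \<open>d\<close> edge lists at \<open>v\<close>.  Since \<open>4d < 4(d + 2)\<close>,
  double counting finds such an \<open>x\<close>, except when \<open>d = 2\<close> and \<open>v\<close> has the same list as both its edges.
  If this exception occurs at every vertex, all lists near \<open>v\<close> are the same four colors, and
  recoloring at most one neighbor of \<open>v\<close> makes the extension possible.
\<close>

section \<open>Split colorings and their extension by one vertex\<close>

text \<open>\<open>E\<close> stays fixed and induced subgraphs arise by shrinking \<open>W\<close>,
  so the induction runs over vertex sets alone.\<close>

definition nbrs :: "('v \<times> 'v) set \<Rightarrow> 'v set \<Rightarrow> 'v \<Rightarrow> 'v set" where
  "nbrs E W v = {u \<in> W. (v, u) \<in> E}"

definition has_unique :: "'a set \<Rightarrow> ('a \<Rightarrow> 'c) \<Rightarrow> bool" where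
  "has_unique N g \<longleftrightarrow> (\<exists>w\<in>N. \<forall>w'\<in>N. g w' = g w \<longrightarrow> w' = w)"

text \<open>
  A coloring of the subdivision of the graph induced by \<open>E\<close> on \<open>W\<close>, split into the colors \<open>a\<close> of
  original vertices and the colors \<open>b\<close> of subdivision vertices.
\<close>

definition split_coloring ::
    "('v \<times> 'v) set \<Rightarrow> 'v set \<Rightarrow> ('v \<Rightarrow> 'c set) \<Rightarrow> ('v set \<Rightarrow> 'c set) \<Rightarrow> ('v \<Rightarrow> 'c) \<Rightarrow> ('v set \<Rightarrow> 'c) \<Rightarrow> bool" where
  "split_coloring E W A B a b \<longleftrightarrow>
     (\<forall>v\<in>W. a v \<in> A v) \<and>
     (\<forall>u\<in>W. \<forall>v\<in>nbrs E W u. b {u, v} \<in> B {u, v} \<and> a u \<noteq> a v \<and> b {u, v} \<noteq> a u) \<and>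
     (\<forall>v\<in>W. nbrs E W v \<noteq> {} \<longrightarrow> has_unique (nbrs E W v) (\<lambda>w. b {v, w}))"

text \<open>The color \<open>r u\<close> occurs on exactly one old edge at \<open>u\<close>; the new
  edge \<open>{v, u}\<close> avoids it, so it stays unique at \<open>u\<close>. If \<open>u\<close>
  has no old edge, the new one is its only edge. The lists \<open>A'\<close> may be smaller than
  \<open>A\<close>, so that a color can be kept free for \<open>v\<close> beforehand.\<close>

lemma split_coloring_extend:
  assumes sym: "sym E" and irr: "irrefl E" and v: "v \<in> W"
    and col: "split_coloring E (W - {v}) A' B a b"
    and sub: "\<And>u. u \<in> W - {v} \<Longrightarrow> A' u \<subseteq> A u"
    and x: "x \<in> A v" "\<And>u. u \<in> nbrs E W v \<Longrightarrow> x \<noteq> a u"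
    and r: "\<And>u. u \<in> nbrs E W v \<Longrightarrow> nbrs E (W - {v}) u \<noteq> {} \<Longrightarrow>
      \<exists>w\<in>nbrs E (W - {v}) u. b {u, w} = r u \<and>
        (\<forall>w'\<in>nbrs E (W - {v}) u. b {u, w'} = b {u, w} \<longrightarrow> w' = w)"
    and g: "\<And>u. u \<in> nbrs E W v \<Longrightarrow> g u \<in> B {v, u} - {x, a u, r u}"
    and uniq: "nbrs E W v \<noteq> {} \<Longrightarrow> has_unique (nbrs E W v) g"
  shows "\<exists>a b. split_coloring E W A B a b"
proof -
  define a' where "a' = a(v := x)"
  \<comment> \<open>An edge at \<open>v\<close> is identified by its other end, the sole element of
    \<open>e - {v}\<close>.\<close>
  define b' where "b' e = (if v \<in> e then g (the_elem (e - {v})) else b e)" for e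
  have symD: "(u, w) \<in> E \<longleftrightarrow> (w, u) \<in> E" for u w
    using sym by (auto dest: symD)
  have loop: "(u, u) \<notin> E" for u
    using irr by (auto simp: irrefl_def)
  have b'v: "b' {v, u} = g u" "b' {u, v} = g u" if "u \<noteq> v" for u
  proof -
    have "{v, u} - {v} = {u}" "{u, v} - {v} = {u}" using that by auto
    then show "b' {v, u} = g u" "b' {u, v} = g u" by (simp_all add: b'_def)
  qed
  have b'o: "b' {u, w} = b {u, w}" if "u \<noteq> v" "w \<noteq> v" for u w
    using that by (simp add: b'_def)
  have nv: "u \<in> nbrs E W v \<Longrightarrow> u \<noteq> v \<and> u \<in> W" for u
    using loop by (auto simp: nbrs_def)
  have nu: "nbrs E W u = (if (v, u) \<in> E then insert v (nbrs E (W - {v}) u) else nbrs E (W - {v}) u)" for u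
    using v symD by (auto simp: nbrs_def)
  have nH: "w \<in> nbrs E (W - {v}) u \<Longrightarrow> w \<noteq> v" for u w
    by (auto simp: nbrs_def)
  have c1: "\<And>u. u \<in> W - {v} \<Longrightarrow> a u \<in> A u"
    and c2: "\<And>u w. u \<in> W - {v} \<Longrightarrow> w \<in> nbrs E (W - {v}) u \<Longrightarrow>
        b {u, w} \<in> B {u, w} \<and> a u \<noteq> a w \<and> b {u, w} \<noteq> a u"
    and c3: "\<And>u. u \<in> W - {v} \<Longrightarrow> nbrs E (W - {v}) u \<noteq> {} \<Longrightarrow>
        has_unique (nbrs E (W - {v}) u) (\<lambda>w. b {u, w})"
    using col sub unfolding split_coloring_def by blast+
  have "a' u \<in> A u" if "u \<in> W" for u
    using that c1 x(1) by (auto simp: a'_def)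
  moreover have "b' {u, w} \<in> B {u, w} \<and> a' u \<noteq> a' w \<and> b' {u, w} \<noteq> a' u"
    if "u \<in> W" "w \<in> nbrs E W u" for u w
  proof -
    consider "u = v" | "u \<noteq> v" "w = v" | "u \<noteq> v" "w \<noteq> v" by blast
    then show ?thesis
    proof cases
      case 1
      then show ?thesis using that nv[of w] b'v[of w] g[of w] x(2)[of w] by (simp add: a'_def)
    next
      case 2
      then have "u \<in> nbrs E W v" using that symD by (auto simp: nbrs_def)
      then show ?thesis
        using 2 b'v[of u] g[of u] x(2)[of u] by (auto simp: a'_def insert_commute)
    next
      case 3
      then have "w \<in> nbrs E (W - {v}) u" using that by (auto simp: nbrs_def)
      then show ?thesis using c2[of u w] 3 that b'o[of u w] by (simp add: a'_def)
    qed
  qed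
  moreover have "has_unique (nbrs E W u) (\<lambda>w. b' {u, w})" if "u \<in> W" "nbrs E W u \<noteq> {}" for u
  proof -
    consider "u = v" | "u \<noteq> v" "(v, u) \<in> E" | "u \<noteq> v" "(v, u) \<notin> E" by blast
    then show ?thesis
    proof cases
      case 1
      then have "has_unique (nbrs E W v) g" using uniq that by simp
      then show ?thesis using 1 nv b'v unfolding has_unique_def by metis
    next
      case 2
      then have uN: "u \<in> nbrs E W v" using that by (simp add: nbrs_def)
      have eq: "nbrs E W u = insert v (nbrs E (W - {v}) u)" using 2 nu[of u] by simp
      show ?thesis
      proof (cases "nbrs E (W - {v}) u = {}")
        case True
        then show ?thesis using eq by (simp add: has_unique_def)
      next
        case False
        obtain w where w: "w \<in> nbrs E (W - {v}) u" "b {u, w} = r u"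
          "\<And>w'. w' \<in> nbrs E (W - {v}) u \<Longrightarrow> b {u, w'} = b {u, w} \<Longrightarrow> w' = w"
          using r[OF uN False] by blast
        have "b' {u, v} \<noteq> b {u, w}" using b'v 2 g[OF uN] w(2) by simp
        then show ?thesis
          using w nH b'o 2 eq unfolding has_unique_def by (metis insertE insertI2)
      qed
    next
      case 3
      then have "nbrs E W u = nbrs E (W - {v}) u" using nu by simp
      then have "has_unique (nbrs E W u) (\<lambda>w. b {u, w})" using c3[of u] 3 that by auto
      then show ?thesis
        using 3 that b'o nH \<open>nbrs E W u = nbrs E (W - {v}) u\<close> unfolding has_unique_def by metis
    qed
  qed
  ultimately have "split_coloring E W A B a' b'"
    unfolding split_coloring_def by blast
  then show ?thesis by blast
qed

text \<open>Supplies the function \<open>r\<close> for \<open>split_coloring_extend\<close>; its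
  value at a vertex without neighbors is arbitrary.\<close>

lemma split_coloring_unique_color:
  assumes "split_coloring E W A B a b" "W' \<subseteq> W"
  shows "\<exists>r. \<forall>u\<in>W'. nbrs E W u \<noteq> {} \<longrightarrow>
      (\<exists>w\<in>nbrs E W u. b {u, w} = r u \<and> (\<forall>w'\<in>nbrs E W u. b {u, w'} = b {u, w} \<longrightarrow> w' = w))"
proof (intro bchoice ballI)
  fix u assume "u \<in> W'"
  then have "nbrs E W u \<noteq> {} \<longrightarrow> has_unique (nbrs E W u) (\<lambda>w. b {u, w})"
    using assms unfolding split_coloring_def by blast
  then show "\<exists>c. nbrs E W u \<noteq> {} \<longrightarrow>
      (\<exists>w\<in>nbrs E W u. b {u, w} = c \<and> (\<forall>w'\<in>nbrs E W u. b {u, w'} = b {u, w} \<longrightarrow> w' = w))"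
    unfolding has_unique_def by blast
qed

section \<open>Choosing the edge colors at one vertex\<close>

text \<open>Exactly one element \<open>w\<close> receives \<open>c\<close>: the one forced to it if
  there is one, otherwise \<open>u\<^sub>0\<close>. Every other \<open>F u\<close> is non-empty and
  different from \<open>{c}\<close>, so it offers another color.\<close>

lemma selection_with_unique_color:
  assumes fin: "finite N" and ne: "\<And>u. u \<in> N \<Longrightarrow> F u \<noteq> {}"
    and c: "u\<^sub>0 \<in> N" "c \<in> F u\<^sub>0" and one: "card {u \<in> N. F u = {c}} \<le> 1"
  shows "\<exists>g. (\<forall>u\<in>N. g u \<in> F u) \<and> has_unique N g"
proof -
  obtain w where w: "w \<in> N" "c \<in> F w" "\<And>u. u \<in> N \<Longrightarrow> F u = {c} \<Longrightarrow> u = w"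
  proof (cases "{u \<in> N. F u = {c}} = {}")
    case True
    then show ?thesis using that[of "u\<^sub>0"] c by blast
  next
    case False
    then obtain w where w: "w \<in> N" "F w = {c}" by blast
    have "u = w" if "u \<in> N" "F u = {c}" for u
      using one that w fin card_le_Suc0_iff_eq[of "{u \<in> N. F u = {c}}"] by auto
    then show ?thesis using that[of w] w by blast
  qed
  have "\<exists>d. d \<in> F u \<and> (u = w \<longrightarrow> d = c) \<and> (u \<noteq> w \<longrightarrow> d \<noteq> c)" if "u \<in> N" for u
  proof (cases "u = w")
    case False
    then have "F u \<noteq> {c}" "F u \<noteq> {}" using w(3) ne that by blast+
    then show ?thesis using False by blast
  qed (use w in blast)
  then obtain g where "\<forall>u\<in>N. g u \<in> F u \<and> (u = w \<longrightarrow> g u = c) \<and> (u \<noteq> w \<longrightarrow> g u \<noteq> c)"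
    by metis
  then show ?thesis using w(1) unfolding has_unique_def by metis
qed

text \<open>Unless \<open>N\<close> has one element, some \<open>F u\<close> contains two colors.
  The elements forced to the first and those forced to the second are disjoint sets with at most
  three elements together, so one of the two colors is forced at most once.\<close>

lemma selection_few_singletons:
  assumes fin: "finite N" and ne: "\<And>u. u \<in> N \<Longrightarrow> F u \<noteq> {}" and "N \<noteq> {}"
    and few: "card N = 1 \<or> card {u \<in> N. is_singleton (F u)} \<le> 3 \<and> card {u \<in> N. is_singleton (F u)} < card N"
  shows "\<exists>g. (\<forall>u\<in>N. g u \<in> F u) \<and> has_unique N g"
proof (cases "card N = 1")
  case True
  then obtain u where "N = {u}" by (auto simp: card_1_singleton_iff)
  moreover obtain c where "c \<in> F u" using ne calculation by blast
  ultimately show ?thesis by (auto simp: has_unique_def intro!: exI[of _ "\<lambda>_. c"])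
next
  case False
  let ?S = "{u \<in> N. is_singleton (F u)}"
  let ?C = "\<lambda>c. {u \<in> N. F u = {c}}"
  have S: "card ?S \<le> 3" "card ?S < card N" using few False by auto
  then have "?S \<noteq> N" by auto
  then obtain u where u: "u \<in> N" "\<not> is_singleton (F u)" by blast
  then obtain c d where cd: "c \<in> F u" "d \<in> F u" "c \<noteq> d"
    using ne[of u] by (metis ex_in_conv is_singletonI')
  have "card (?C c) + card (?C d) = card (?C c \<union> ?C d)"
    using fin cd(3) by (subst card_Un_disjoint) auto
  also have "\<dots> \<le> card ?S"
    using fin by (intro card_mono) (auto simp: is_singleton_def)
  finally have "card (?C c) \<le> 1 \<or> card (?C d) \<le> 1" using S by linarith
  then show ?thesis
    using selection_with_unique_color[of N F u, OF fin ne u(1)] cd by blast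
qed

lemma card_Diff3_ge:
  assumes "finite X"
  shows "card X \<le> card (X - {p, q}) + 2" "card X \<le> card (X - {p, q, r}) + 3"
proof -
  have "card X - card {p, q} \<le> card (X - {p, q})" "card X - card {p, q, r} \<le> card (X - {p, q, r})"
    by (rule diff_card_le_card_Diff; simp)+
  moreover have "card {p, q} \<le> 2" "card {p, q, r} \<le> 3"
    by (auto simp: card_insert_if)
  ultimately show "card X \<le> card (X - {p, q}) + 2" "card X \<le> card (X - {p, q, r}) + 3"
    by linarith+
qed

section \<open>Removing and restoring a vertex\<close>

text \<open>\<open>IH\<close> ranges over all lists because \<open>x\<close> is deleted from those
  of the neighbors of \<open>v\<close>; each of them has lost one neighbor, so the size bound
  survives.\<close>

lemma split_coloring_reduce:
  assumes sym: "sym E" and irr: "irrefl E" and fin: "finite W" and v: "v \<in> W"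
    and A: "\<And>u. u \<in> W \<Longrightarrow> card (nbrs E W u) + 2 \<le> card (A u)"
    and B: "\<And>u w. u \<in> W \<Longrightarrow> w \<in> nbrs E W u \<Longrightarrow> card (B {u, w}) = 4"
    and x: "x \<in> A v"
    and few: "card (nbrs E W v) \<le> 1 \<or>
      card {u \<in> nbrs E W v. x \<in> B {v, u}} \<le> 3 \<and> card {u \<in> nbrs E W v. x \<in> B {v, u}} < card (nbrs E W v)"
    and IH: "\<And>A'. (\<And>u. u \<in> W - {v} \<Longrightarrow> card (nbrs E (W - {v}) u) + 2 \<le> card (A' u)) \<Longrightarrow>
      \<exists>a b. split_coloring E (W - {v}) A' B a b"
  shows "\<exists>a b. split_coloring E W A B a b"
proof -
  let ?N = "nbrs E W v"
  define A' where "A' u = (if u \<in> ?N then A u - {x} else A u)" for u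
  have finN: "finite ?N" using fin by (simp add: nbrs_def)
  have "card (nbrs E (W - {v}) u) + 2 \<le> card (A' u)" if u: "u \<in> W - {v}" for u
  proof (cases "u \<in> ?N")
    case True
    then have "nbrs E W u = insert v (nbrs E (W - {v}) u)"
      using v sym by (auto simp: nbrs_def dest: symD)
    then have "card (nbrs E W u) = Suc (card (nbrs E (W - {v}) u))"
      using fin by (simp add: nbrs_def)
    then have "card (nbrs E (W - {v}) u) + 3 \<le> card (A u)" using A[of u] u by simp
    moreover have "card (A u) \<le> card (A u - {x}) + 1"
      by (simp add: card_Diff_singleton_if le_Suc_eq) linarith
    ultimately show ?thesis using True by (simp add: A'_def)
  next
    case False
    have "nbrs E (W - {v}) u \<subseteq> nbrs E W u" "finite (nbrs E W u)" using fin by (auto simp: nbrs_def)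
    then have "card (nbrs E (W - {v}) u) \<le> card (nbrs E W u)" by (rule card_mono[rotated])
    then show ?thesis using A[of u] u False by (simp add: A'_def)
  qed
  then obtain a b where col: "split_coloring E (W - {v}) A' B a b" using IH by blast
  have NW: "?N \<subseteq> W - {v}" using irr by (auto simp: nbrs_def irrefl_def)
  obtain r where r: "\<forall>u\<in>?N. nbrs E (W - {v}) u \<noteq> {} \<longrightarrow>
      (\<exists>w\<in>nbrs E (W - {v}) u. b {u, w} = r u \<and>
        (\<forall>w'\<in>nbrs E (W - {v}) u. b {u, w'} = b {u, w} \<longrightarrow> w' = w))"
    using split_coloring_unique_color[OF col NW] by (elim exE) (rule that)
  have ax: "x \<noteq> a u" if "u \<in> ?N" for u
  proof -
    have "a u \<in> A' u" using col that NW unfolding split_coloring_def by blast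
    then show ?thesis using that by (auto simp: A'_def)
  qed
  \<comment> \<open>Three forbidden colors leave at least one of four. If \<open>x\<close> is not in
    the edge list, only two are lost and at least two remain, so only edges with \<open>x\<close> in
    their list can be forced.\<close>
  define F where "F u = B {v, u} - {x, a u, r u}" for u
  have B4: "card (B {v, u}) = 4" "finite (B {v, u})" if "u \<in> ?N" for u
    using B[OF v that] by (auto intro: card_ge_0_finite)
  have ne: "F u \<noteq> {}" if "u \<in> ?N" for u
    using card_Diff3_ge(2)[OF B4(2)[OF that], of x "a u" "r u"] B4(1)[OF that] unfolding F_def
    by (metis add_0 card.empty numeral_le_iff semiring_norm(69) semiring_norm(72))
  have single: "x \<in> B {v, u}" if "u \<in> ?N" "is_singleton (F u)" for u
  proof (rule ccontr)
    assume "x \<notin> B {v, u}"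
    then have "F u = B {v, u} - {a u, r u}" by (auto simp: F_def)
    then have "2 \<le> card (F u)"
      using card_Diff3_ge(1)[OF B4(2)[OF that(1)], of "a u" "r u"] B4(1)[OF that(1)] by simp
    then show False using that(2) by (simp add: is_singleton_altdef)
  qed
  have "\<exists>g. (\<forall>u\<in>?N. g u \<in> F u) \<and> (?N \<noteq> {} \<longrightarrow> has_unique ?N g)"
  proof (cases "?N = {}")
    case False
    have "card {u \<in> ?N. is_singleton (F u)} \<le> card {u \<in> ?N. x \<in> B {v, u}}"
      using finN single by (intro card_mono) auto
    \<comment> \<open>Turns the alternative \<open>card ?N \<le> 1\<close> of \<open>few\<close>
      into \<open>card ?N = 1\<close>.\<close>
    moreover have "card ?N \<noteq> 0" using finN False by simp
    ultimately have "card ?N = 1 \<or> card {u \<in> ?N. is_singleton (F u)} \<le> 3 \<and>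
        card {u \<in> ?N. is_singleton (F u)} < card ?N"
      using few by linarith
    then show ?thesis using selection_few_singletons[of ?N F, OF finN ne False] by blast
  qed simp
  then obtain g where g: "\<forall>u\<in>?N. g u \<in> F u" "?N \<noteq> {} \<longrightarrow> has_unique ?N g" by blast
  show ?thesis
    by (rule split_coloring_extend[OF sym irr v col, where r = r and g = g])
      (use x ax r g in \<open>auto simp: A'_def F_def\<close>)
qed

section \<open>Double counting over the edge lists\<close>

text \<open>By \<open>irred\<close>, each \<open>x \<in> A\<close> lies in at least
  \<open>min 4 (card N)\<close> of the sets \<open>B u\<close>, whose sizes sum to
  \<open>4 * card N\<close>. As \<open>A\<close> has at least \<open>card N + 2\<close> colors, only
  \<open>card N = 2\<close> survives; then every \<open>x \<in> A\<close> lies in both sets, and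
  these have only four elements.\<close>

lemma exists_reducing_color:
  assumes fin: "finite N" and A: "card N + 2 \<le> card A"
    and B: "\<And>u. u \<in> N \<Longrightarrow> card (B u) = 4"
    and irred: "\<And>x. x \<in> A \<Longrightarrow> \<not> (card N \<le> 1 \<or> card {u \<in> N. x \<in> B u} \<le> 3 \<and> card {u \<in> N. x \<in> B u} < card N)"
  shows "card N = 2 \<and> (\<forall>u\<in>N. B u = A)"
proof -
  have finA: "finite A" using A by (intro card_ge_0_finite) simp
  have finB: "finite (B u)" if "u \<in> N" for u using B[OF that] by (intro card_ge_0_finite) simp
  obtain x\<^sub>0 where "x\<^sub>0 \<in> A" using A by fastforce
  then have N2: "2 \<le> card N" using irred by fastforce
  have "card A * min 4 (card N) = (\<Sum>x\<in>A. min 4 (card N))" by simp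
  also have "\<dots> \<le> (\<Sum>x\<in>A. card {u \<in> N. x \<in> B u})"
    using irred by (intro sum_mono) fastforce
  also have "\<dots> = (\<Sum>u\<in>N. card {x \<in> A. x \<in> B u})"
    using sum.swap_restrict[OF finA fin, of "\<lambda>_ _. 1::nat" "\<lambda>x u. x \<in> B u"] by simp
  also have "\<dots> \<le> (\<Sum>u\<in>N. 4)"
    using B finB by (intro sum_mono) (metis (no_types, lifting) card_mono mem_Collect_eq subsetI)
  finally have le: "card A * min 4 (card N) \<le> card N * 4" by simp
  have "card N = 2"
  proof (rule ccontr)
    assume "card N \<noteq> 2"
    \<comment> \<open>Three sets would give at least \<open>5 * 3 \<le> 12\<close>, and more sets
      \<open>(card N + 2) * 4 \<le> card N * 4\<close>.\<close>
    then consider "card N = 3" | "4 \<le> card N" using N2 by linarith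
    then show False
      using le A by cases (simp_all add: min_def)
  qed
  moreover have "B u = A" if "u \<in> N" for u
  proof -
    have "A \<subseteq> B u"
    proof
      fix x assume "x \<in> A"
      have "card {u \<in> N. x \<in> B u} \<le> card N" using fin by (intro card_mono) auto
      then have "card {u \<in> N. x \<in> B u} = card N" using irred[OF \<open>x \<in> A\<close>] \<open>card N = 2\<close> by linarith
      then have "{u \<in> N. x \<in> B u} = N" using fin by (intro card_subset_eq) auto
      then show "x \<in> B u" using that by blast
    qed
    moreover have "card (B u) \<le> card A" using A B[OF that] \<open>card N = 2\<close> by simp
    ultimately show ?thesis using card_seteq[OF finB[OF that], of A] by simp
  qed
  ultimately show ?thesis by blast
qed

section \<open>The exceptional case of equal lists\<close>

text \<open>Here \<open>p\<^sub>1\<close>, \<open>p\<^sub>2\<close> are the colors of the two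
  neighbors of the removed vertex, \<open>q\<^sub>1\<close>, \<open>q\<^sub>2\<close> those of their
  other edges, and \<open>z\<close> that of the other neighbor of the first one. The first neighbor
  is recolored to \<open>p\<close>, the restored vertex gets \<open>x\<close>, and its two edges get
  \<open>c\<close> and \<open>d\<close>.\<close>

lemma four_color_step:
  assumes K: "card K = 4" and p: "p\<^sub>1 \<in> K" "p\<^sub>2 \<in> K"
    and ne: "p\<^sub>1 \<noteq> q\<^sub>1" "z \<noteq> p\<^sub>1" "z \<noteq> q\<^sub>1" "p\<^sub>2 \<noteq> q\<^sub>2"
  shows "\<exists>p\<in>K. \<exists>x\<in>K. \<exists>c\<in>K. \<exists>d\<in>K. p \<noteq> z \<and> p \<noteq> q\<^sub>1 \<and> x \<noteq> p \<and> x \<noteq> p\<^sub>2 \<and>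
    c \<notin> {p, q\<^sub>1, x} \<and> d \<notin> {p\<^sub>2, q\<^sub>2, x} \<and> c \<noteq> d"
proof (cases "p\<^sub>1 = p\<^sub>2")
  case True
  have "card (K - {p\<^sub>1}) = 3" using K p by simp
  then obtain k l m where klm: "K - {p\<^sub>1} = {k, l, m}" "k \<noteq> l" "k \<noteq> m" "l \<noteq> m"
    by (auto simp: card_3_iff)
  then have K_eq: "K = {p\<^sub>1, k, l, m}" "p\<^sub>1 \<notin> {k, l, m}" using p by auto
  \<comment> \<open>Letting \<open>x\<close> coincide with \<open>q\<^sub>1\<close> when possible
    leaves two choices for \<open>c\<close> in \<open>{k, l, m}\<close>; at least one remains for
    \<open>d\<close>, so they can differ.\<close>
  obtain x where x: "x \<in> {k, l, m}" "q\<^sub>1 \<in> {k, l, m} \<longrightarrow> x = q\<^sub>1" by blast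
  have "\<exists>c\<in>{k,l,m}. \<exists>d\<in>{k,l,m}. c \<notin> {q\<^sub>1, x} \<and> d \<notin> {q\<^sub>2, x} \<and> c \<noteq> d"
    using x klm by auto
  then obtain c d where "c \<in> {k,l,m}" "d \<in> {k,l,m}" "c \<notin> {q\<^sub>1, x}" "d \<notin> {q\<^sub>2, x}" "c \<noteq> d"
    by (elim bexE conjE) (rule that)
  then show ?thesis using x(1) K_eq True ne
    by - (rule bexI[of _ "p\<^sub>1"], rule bexI[of _ x], rule bexI[of _ c], rule bexI[of _ d], auto)
next
  case False
  then have "card (K - {p\<^sub>1, p\<^sub>2}) = 2" using K p by (simp add: card_Diff_subset)
  then obtain k l where kl: "K - {p\<^sub>1, p\<^sub>2} = {k, l}" "k \<noteq> l" by (auto simp: card_2_iff)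
  then have K_eq: "K = {p\<^sub>1, p\<^sub>2, k, l}" "k \<notin> {p\<^sub>1, p\<^sub>2}" "l \<notin> {p\<^sub>1, p\<^sub>2}" using p by auto
  show ?thesis
  proof (cases "q\<^sub>1 = p\<^sub>2 \<and> q\<^sub>2 = p\<^sub>1")
    case True
    \<comment> \<open>Here both old colors leave only \<open>k\<close> and \<open>l\<close> for all three new elements, so \<open>p\<^sub>1\<close> must change.\<close>
    obtain s t where "{s, t} = {k, l}" "s \<noteq> z" "s \<noteq> t" using kl(2) by (metis insert_commute)
    then show ?thesis using True K_eq False ne
      by - (rule bexI[of _ s], rule bexI[of _ "p\<^sub>1"], rule bexI[of _ t], rule bexI[of _ s],
          auto simp: doubleton_eq_iff)
  next
    \<comment> \<open>Keep \<open>p\<^sub>1\<close> and take \<open>x = k\<close>. Then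
      \<open>c = p\<^sub>2\<close> fails only if \<open>q\<^sub>1 = p\<^sub>2\<close>, and
      \<open>d = p\<^sub>1\<close> only if \<open>q\<^sub>2 = p\<^sub>1\<close>; not both fail, so
      \<open>l\<close> is needed on at most one edge.\<close>
    case False': False
    have "\<exists>c\<in>{p\<^sub>2, l}. \<exists>d\<in>{p\<^sub>1, l}. c \<noteq> q\<^sub>1 \<and> d \<noteq> q\<^sub>2 \<and> c \<noteq> d"
      using False' False K_eq by auto
    then obtain c d where "c \<in> {p\<^sub>2, l}" "d \<in> {p\<^sub>1, l}" "c \<noteq> q\<^sub>1" "d \<noteq> q\<^sub>2" "c \<noteq> d"
      by (elim bexE conjE) (rule that)
    then show ?thesis using K_eq kl(2) False ne
      by - (rule bexI[of _ "p\<^sub>1"], rule bexI[of _ k], rule bexI[of _ c], rule bexI[of _ d], auto)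
  qed
qed

text \<open>By \<open>eq\<close>, an edge has the list of each of its ends, so \<open>v\<close>, its
  neighbors and all their edges share the four colors of \<open>A v\<close>. This reduces the
  extension to \<open>four_color_step\<close>.\<close>

lemma split_coloring_equal_lists:
  assumes sym: "sym E" and irr: "irrefl E" and v: "v \<in> W"
    and deg: "\<And>u. u \<in> W \<Longrightarrow> card (nbrs E W u) = 2"
    and eq: "\<And>u w. u \<in> W \<Longrightarrow> w \<in> nbrs E W u \<Longrightarrow> B {u, w} = A u"
    and K: "card (A v) = 4"
    and col: "split_coloring E (W - {v}) A B a b"
  shows "\<exists>a b. split_coloring E W A B a b"
proof -
  have nbr_sym: "w \<in> nbrs E W u \<longleftrightarrow> u \<in> nbrs E W w" if "u \<in> W" "w \<in> W" for u w
    using that sym by (auto simp: nbrs_def dest: symD)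
  obtain u\<^sub>1 u\<^sub>2 where N: "nbrs E W v = {u\<^sub>1, u\<^sub>2}" and u12: "u\<^sub>1 \<noteq> u\<^sub>2"
    using deg[OF v] by (auto simp: card_2_iff)
  have other: "\<exists>w. nbrs E (W - {v}) u = {w} \<and> w \<noteq> u \<and> w \<in> W - {v}" if "u \<in> nbrs E W v" for u
  proof -
    have u: "u \<in> W" "v \<in> nbrs E W u" "u \<notin> nbrs E W u"
      using that v sym irr by (auto simp: nbrs_def irrefl_def dest: symD)
    then have "card (nbrs E W u - {v}) = 1" using deg[OF u(1)] by simp
    moreover have "nbrs E W u - {v} = nbrs E (W - {v}) u" by (auto simp: nbrs_def)
    ultimately obtain w where "nbrs E (W - {v}) u = {w}" by (metis card_1_singletonE)
    then show ?thesis using u by (auto simp: nbrs_def)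
  qed
  obtain w\<^sub>1 w\<^sub>2 where w1: "nbrs E (W - {v}) u\<^sub>1 = {w\<^sub>1}" "w\<^sub>1 \<noteq> u\<^sub>1" "w\<^sub>1 \<in> W - {v}"
    and w2: "nbrs E (W - {v}) u\<^sub>2 = {w\<^sub>2}"
    using other[of "u\<^sub>1"] other[of "u\<^sub>2"] N by auto
  have uW: "u\<^sub>1 \<in> W - {v}" "u\<^sub>2 \<in> W - {v}"
    using N irr by (auto simp: nbrs_def irrefl_def)
  have Au: "A u = A v" "B {v, u} = A v" if "u \<in> nbrs E W v" for u
  proof -
    have "u \<in> W" using that by (simp add: nbrs_def)
    then have "B {u, v} = A u" using eq nbr_sym v that by blast
    then show "A u = A v" "B {v, u} = A v" using eq[OF v that] by (simp_all add: insert_commute)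
  qed
  have c: "a u \<in> A u" "w \<in> nbrs E (W - {v}) u \<Longrightarrow> b {u, w} \<in> B {u, w} \<and> a u \<noteq> a w \<and> b {u, w} \<noteq> a u"
    if "u \<in> W - {v}" for u w
    using col that unfolding split_coloring_def by blast+
  have "u\<^sub>1 \<in> nbrs E (W - {v}) w\<^sub>1"
    using w1 uW sym by (auto simp: nbrs_def dest: symD)
  \<comment> \<open>The edge is read from its end \<open>w\<^sub>1\<close>, which gives the
    hypothesis \<open>z \<noteq> q\<^sub>1\<close> of \<open>four_color_step\<close>.\<close>
  from c(2)[OF w1(3) this] have z: "b {u\<^sub>1, w\<^sub>1} \<noteq> a w\<^sub>1" by (simp add: insert_commute)
  have "\<exists>p\<in>A v. \<exists>x\<in>A v. \<exists>c\<in>A v. \<exists>d\<in>A v. p \<noteq> a w\<^sub>1 \<and> p \<noteq> b {u\<^sub>1, w\<^sub>1} \<and> x \<noteq> p \<and> x \<noteq> a u\<^sub>2 \<and>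
      c \<notin> {p, b {u\<^sub>1, w\<^sub>1}, x} \<and> d \<notin> {a u\<^sub>2, b {u\<^sub>2, w\<^sub>2}, x} \<and> c \<noteq> d"
    by (rule four_color_step[OF K, of "a u\<^sub>1"])
      (use c(1)[OF uW(1)] c(1)[OF uW(2)] Au N c(2)[OF uW(1), of "w\<^sub>1"] c(2)[OF uW(2), of "w\<^sub>2"] w1 w2 z in auto)
  then obtain p x c' d where pxcd: "p \<in> A v" "x \<in> A v" "c' \<in> A v" "d \<in> A v"
      "p \<noteq> a w\<^sub>1" "p \<noteq> b {u\<^sub>1, w\<^sub>1}" "x \<noteq> p" "x \<noteq> a u\<^sub>2"
      "c' \<notin> {p, b {u\<^sub>1, w\<^sub>1}, x}" "d \<notin> {a u\<^sub>2, b {u\<^sub>2, w\<^sub>2}, x}" "c' \<noteq> d"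
    by (elim bexE conjE) (rule that)
  have only: "u\<^sub>1 \<in> nbrs E (W - {v}) u \<Longrightarrow> u = w\<^sub>1" if "u \<in> W - {v}" for u
  proof -
    assume "u\<^sub>1 \<in> nbrs E (W - {v}) u"
    then have "u \<in> nbrs E (W - {v}) u\<^sub>1" using that sym by (auto simp: nbrs_def dest: symD)
    then show "u = w\<^sub>1" using w1 by simp
  qed
  \<comment> \<open>Only \<open>w\<^sub>1\<close> and the edge to it meet the recolored vertex, and
    \<open>p\<close> avoids both their colors. Edge colors do not change, so uniqueness
    persists.\<close>
  have col': "split_coloring E (W - {v}) A B (a(u\<^sub>1 := p)) b"
    unfolding split_coloring_def
  proof (intro conjI ballI)
    fix u assume "u \<in> W - {v}"
    then show "(a(u\<^sub>1 := p)) u \<in> A u" using c(1) Au N pxcd(1) by simp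
  next
    fix u w assume u: "u \<in> W - {v}" and w: "w \<in> nbrs E (W - {v}) u"
    note c(2)[OF u w]
    moreover have "u = u\<^sub>1 \<Longrightarrow> w = w\<^sub>1" using w w1 by simp
    moreover have "w = u\<^sub>1 \<Longrightarrow> u = w\<^sub>1" using only u w by blast
    ultimately show "b {u, w} \<in> B {u, w}" "(a(u\<^sub>1 := p)) u \<noteq> (a(u\<^sub>1 := p)) w" "b {u, w} \<noteq> (a(u\<^sub>1 := p)) u"
      using pxcd w1(2) by auto
  next
    fix u assume "u \<in> W - {v}"
    then show "nbrs E (W - {v}) u \<noteq> {} \<longrightarrow> has_unique (nbrs E (W - {v}) u) (\<lambda>w. b {u, w})"
      using col unfolding split_coloring_def by blast
  qed
  \<comment> \<open>Each of \<open>u\<^sub>1\<close>, \<open>u\<^sub>2\<close> has one old edge,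
    whose color is the one to protect; \<open>c' \<noteq> d\<close> gives uniqueness at
    \<open>v\<close>.\<close>
  show ?thesis
    by (rule split_coloring_extend[OF sym irr v col', where x = x
          and r = "\<lambda>u. if u = u\<^sub>1 then b {u\<^sub>1, w\<^sub>1} else b {u\<^sub>2, w\<^sub>2}" and g = "\<lambda>u. if u = u\<^sub>1 then c' else d"])
      (use pxcd N u12 w1 w2 Au in \<open>auto simp: has_unique_def\<close>)
qed

section \<open>The induction on the vertex set\<close>

text \<open>The lists \<open>A\<close> vary because neighbors of a removed vertex give up a color.
  The lists \<open>B\<close> stay fixed: an edge is kept or removed as a whole.\<close>

lemma exists_split_coloring:
  assumes sym: "sym E" and irr: "irrefl E" and fin: "finite W"
    and A: "\<And>u. u \<in> W \<Longrightarrow> card (nbrs E W u) + 2 \<le> card (A u)"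
    and B: "\<And>u w. u \<in> W \<Longrightarrow> w \<in> nbrs E W u \<Longrightarrow> card (B {u, w}) = 4"
  shows "\<exists>a b. split_coloring E W A B a b"
  using fin A B
proof (induction W arbitrary: A rule: finite_psubset_induct)
  case (psubset W)
  have IH: "\<exists>a b. split_coloring E (W - {v}) A' B a b"
    if "v \<in> W" "\<And>u. u \<in> W - {v} \<Longrightarrow> card (nbrs E (W - {v}) u) + 2 \<le> card (A' u)" for v A'
    by (rule psubset.IH) (use that psubset.prems(2) in \<open>auto simp: nbrs_def\<close>)
  show ?case
  proof (cases "\<exists>v\<in>W. \<exists>x\<in>A v. card (nbrs E W v) \<le> 1 \<or>
      card {u \<in> nbrs E W v. x \<in> B {v, u}} \<le> 3 \<and> card {u \<in> nbrs E W v. x \<in> B {v, u}} < card (nbrs E W v)")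
    case True
    then obtain v x where "v \<in> W" "x \<in> A v" "card (nbrs E W v) \<le> 1 \<or>
      card {u \<in> nbrs E W v. x \<in> B {v, u}} \<le> 3 \<and> card {u \<in> nbrs E W v. x \<in> B {v, u}} < card (nbrs E W v)"
      by blast
    then show ?thesis
      using IH psubset.prems by (intro split_coloring_reduce[OF sym irr psubset.hyps(1), of v A B x]) auto
  next
    case False
    \<comment> \<open>No vertex has a reducing color, so all of \<open>W\<close> is in the
      exceptional configuration, as \<open>split_coloring_equal_lists\<close> requires.\<close>
    have special: "card (nbrs E W u) = 2 \<and> (\<forall>w\<in>nbrs E W u. B {u, w} = A u)" if "u \<in> W" for u
      using psubset.hyps that psubset.prems[OF that] False
      by (intro exists_reducing_color) (auto simp: nbrs_def)
    show ?thesis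
    proof (cases "W = {}")
      case True
      then show ?thesis by (simp add: split_coloring_def)
    next
      case False
      then obtain v where v: "v \<in> W" by blast
      then obtain w where w: "w \<in> nbrs E W v" using special by fastforce
      have K: "card (A v) = 4" using special[OF v] psubset.prems(2)[OF v w] w by simp
      have "card (nbrs E (W - {v}) u) \<le> card (nbrs E W u)" for u
        using psubset.hyps by (intro card_mono) (auto simp: nbrs_def)
      then have "\<exists>a b. split_coloring E (W - {v}) A B a b"
        using psubset.prems(1) by (intro IH v) (meson DiffD1 add_le_mono1 le_trans)
      then show ?thesis
        using split_coloring_equal_lists[of E v W B A, OF sym irr v _ _ K] special by blast
    qed
  qed
qed

section \<open>Transfer to the 1-subdivision\<close>

text \<open>Cuts possibly infinite lists down to finite ones of the exact size used in the
  induction.\<close>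

lemma exists_subset_with_card:
  assumes "infinite X \<or> n \<le> card X"
  shows "\<exists>T\<subseteq>X. card T = n"
  using assms infinite_arbitrarily_large[of X n] obtain_subset_with_card_n[of n X] by blast

theorem theorem7:
  fixes G :: "'v pair_pre_digraph"
  assumes "pair_graph G"
  shows "proper_conflict_free_degree_plus_choosable TYPE('c) (one_subdivision G) 2"
  unfolding proper_conflict_free_degree_plus_choosable_def proper_conflict_free_choosable_def
proof (intro allI impI)
  fix L :: "'v + 'v set \<Rightarrow> 'c set"
  assume L: "list_assignment (one_subdivision G) (\<lambda>v. out_degree (one_subdivision G) v + 2) L"
  interpret pair_graph G by fact
  let ?S = "one_subdivision G" and ?E = "parcs G" and ?V = "pverts G"
  have sym: "sym ?E" using arcs_symmetric by (auto intro: symI)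
  have irr: "irrefl ?E" by (auto simp: irrefl_def dest: no_loops)
  have wf: "u \<in> ?V" "v \<in> ?V" if "(u, v) \<in> ?E" for u v
    using that by (auto dest: in_arcsD1 in_arcsD2)
  have nbrs: "nbrs ?E ?V v = neighborhood G v" for v
    using wf by (auto simp: nbrs_def neighborhood_def)
  have "\<exists>T\<subseteq>L (Inl v). card T = card (nbrs ?E ?V v) + 2" if "v \<in> ?V" for v
  proof (rule exists_subset_with_card)
    have "card (neighborhood ?S (Inl v)) = card (neighborhood G v)"
      unfolding neighborhood_one_subdivision_Inl by (rule card_image) (auto simp: inj_on_def doubleton_eq_iff)
    moreover have "Inl v \<in> pverts ?S" using that by (simp add: one_subdivision_def)
    ultimately show "infinite (L (Inl v)) \<or> card (nbrs ?E ?V v) + 2 \<le> card (L (Inl v))"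
      using L unfolding list_assignment_def out_degree_eq_card_neighborhood nbrs by metis
  qed
  then obtain A where A: "\<And>v. v \<in> ?V \<Longrightarrow> A v \<subseteq> L (Inl v) \<and> card (A v) = card (nbrs ?E ?V v) + 2"
    by metis
  \<comment> \<open>A subdivision vertex has degree 2, hence four colors.\<close>
  have "\<exists>T\<subseteq>L (Inr e). card T = 4" if "e \<in> uedges G" for e
  proof (rule exists_subset_with_card)
    obtain u v where e: "e = {u, v}" "(u, v) \<in> ?E" using \<open>e \<in> uedges G\<close> by (auto simp: uedges_def)
    then have "u \<noteq> v" using irr by (auto simp: irrefl_def)
    then have "card (neighborhood ?S (Inr e)) = 2"
      using neighborhood_one_subdivision_Inr[OF assms, of u v] e by simp
    moreover have "Inr e \<in> pverts ?S" using that by (simp add: one_subdivision_def)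
    ultimately have "infinite (L (Inr e)) \<or> 2 + 2 \<le> card (L (Inr e))"
      using L unfolding list_assignment_def out_degree_eq_card_neighborhood by metis
    then show "infinite (L (Inr e)) \<or> 4 \<le> card (L (Inr e))" by simp
  qed
  then obtain B where B: "\<And>e. e \<in> uedges G \<Longrightarrow> B e \<subseteq> L (Inr e) \<and> card (B e) = 4"
    by metis
  have edge: "{u, w} \<in> uedges G" if "(u, w) \<in> ?E" for u w
    using that by (auto simp: uedges_def)
  have "\<exists>a b. split_coloring ?E ?V A B a b"
    using A B edge by (intro exists_split_coloring[OF sym irr pair_finite_verts]) (auto simp: nbrs_def)
  then obtain a b where ab: "split_coloring ?E ?V A B a b" by blast
  have va: "a v \<in> A v" if "v \<in> ?V" for v
    using ab that unfolding split_coloring_def by blast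
  have eb: "b {u, v} \<in> B {u, v}" "a u \<noteq> a v" "b {u, v} \<noteq> a u" if "(u, v) \<in> ?E" for u v
    using ab that wf[OF that] unfolding split_coloring_def nbrs_def by blast+
  have "proper_conflict_free_coloring ?S L (case_sum a b)"
    unfolding proper_conflict_free_coloring_def
  proof (intro conjI ballI allI impI)
    fix y assume y: "y \<in> pverts ?S"
    show "case_sum a b y \<in> L y"
    proof (cases y)
      case (Inl v)
      then have "v \<in> ?V" using y by (auto simp: one_subdivision_def)
      then show ?thesis using va[of v] A[of v] Inl by auto
    next
      case (Inr e)
      then have e: "e \<in> uedges G" using y by (auto simp: one_subdivision_def)
      then obtain u v where "e = {u, v}" "(u, v) \<in> ?E" by (auto simp: uedges_def)
      then show ?thesis using eb(1)[of u v] B[OF e] Inr by auto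
    qed
  next
    fix y z assume "y \<rightarrow>\<^bsub>?S\<^esub> z"
    then show "case_sum a b y \<noteq> case_sum a b z"
      using eb(3) eb(3)[symmetric] by (auto simp: one_subdivision_def)
  next
    fix y assume y: "y \<in> pverts ?S" "neighborhood ?S y \<noteq> {}"
    show "\<exists>c. \<exists>!u. u \<in> neighborhood ?S y \<and> case_sum a b u = c"
    proof (cases y)
      case (Inl v)
      then have "v \<in> ?V" using y(1) by (auto simp: one_subdivision_def)
      moreover have "nbrs ?E ?V v \<noteq> {}"
        using y(2) Inl by (auto simp: neighborhood_one_subdivision_Inl nbrs)
      ultimately have "has_unique (nbrs ?E ?V v) (\<lambda>w. b {v, w})"
        using ab unfolding split_coloring_def by blast
      then obtain w where w: "w \<in> neighborhood G v" "\<And>w'. w' \<in> neighborhood G v \<Longrightarrow> b {v, w'} = b {v, w} \<Longrightarrow> w' = w"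
        unfolding has_unique_def nbrs by blast
      show ?thesis
        unfolding Inl neighborhood_one_subdivision_Inl
        by (intro exI[of _ "b {v, w}"] ex1I[of _ "Inr {v, w}"]) (auto simp: w(1) dest: w(2))
    next
      case (Inr e)
      then have "e \<in> uedges G" using y by (auto simp: one_subdivision_def)
      then obtain u v where e: "e = {u, v}" "(u, v) \<in> ?E" by (auto simp: uedges_def)
      \<comment> \<open>The ends \<open>u\<close> and \<open>v\<close> are the two neighbors of the
        subdivision vertex. They are not adjacent in the subdivision, but
        \<open>a u \<noteq> a v\<close> makes each color unique here.\<close>
      show ?thesis
        unfolding Inr e(1) neighborhood_one_subdivision_Inr[OF assms, of u v, simplified, OF e(2)]
        by (intro exI[of _ "a u"] ex1I[of _ "Inl u"]) (use eb(2)[OF e(2)] in auto)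
    qed
  qed
  then show "\<exists>\<phi>. proper_conflict_free_coloring ?S L \<phi>" by blast
qed

end
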